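(* Let $E$ be a Banach lattice. The following are equivalent: (1) $E$ is lattice isomorphic to $c_0$. (2) $E$ is order isomorphic to $c_0$. (3) $E$ is order isomorphic to an infinite dimensional closed sublattice of $c_0$.
   Context: All vector spaces are real. $c_0$ is the Banach lattice of real null sequences with the coordinatewise order and the supremum norm. Two ordered vector spaces $E$ and $F$ are order isomorphic if there is a (not necessarily linear) bijection $T:E\to F$ (called an order isomorphism) such that, for all $x,y\in E$, $x\ge y$ if and only if $Tx\ge Ty$. Banach lattices $E$ and $F$ are lattice isomorphic if there is a linear bijection $T:E\to F$ such that $T|x|=|Tx|$ for all $x\in E$. A sublattice of a Banach lattice is a linear subspace closed under the lattice operations $\vee,\wedge$, with the inherited order. *)

theory Defs
  imports "HOL-Analysis.Analysis" "HOL-Library.Lattice_Algebras"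
begin

text \<open>
  The modulus is the lattice-theoretic one, inherited from the library class
  \<^class>\<open>lattice_ab_group_add_abs\<close>: \<open>\<bar>x\<bar> = sup x (- x)\<close>.
\<close>

class banach_lattice = banach + ordered_real_vector + lattice_ab_group_add_abs +
  assumes norm_mono_abs: "\<bar>x\<bar> \<le> \<bar>y\<bar> \<Longrightarrow> norm x \<le> norm y"

subsection \<open>The Banach lattice of real null sequences\<close>

typedef c0 = "{x :: nat \<Rightarrow> real. x \<longlonglongrightarrow> 0}"
  morphisms c0_nth Abs_c0
  by (rule exI[of _ "\<lambda>_. 0"]) simp

setup_lifting type_definition_c0

lemma c0_eqI: "(\<And>n. c0_nth x n = c0_nth y n) \<Longrightarrow> x = y"
  by (simp add: c0_nth_inject[symmetric] fun_eq_iff)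

lemma c0_nth_tendsto: "c0_nth x \<longlonglongrightarrow> 0"
  using c0_nth[of x] by simp

instantiation c0 :: real_vector
begin

lift_definition zero_c0 :: c0 is "\<lambda>_. 0" by simp
lift_definition plus_c0 :: "c0 \<Rightarrow> c0 \<Rightarrow> c0" is "\<lambda>x y n. x n + y n"
  by (rule tendsto_add_zero)
lift_definition uminus_c0 :: "c0 \<Rightarrow> c0" is "\<lambda>x n. - x n"
  by (drule tendsto_minus) simp
lift_definition minus_c0 :: "c0 \<Rightarrow> c0 \<Rightarrow> c0" is "\<lambda>x y n. x n - y n"
  by (drule (1) tendsto_diff) simp
lift_definition scaleR_c0 :: "real \<Rightarrow> c0 \<Rightarrow> c0" is "\<lambda>r x n. r * x n"
  by (rule tendsto_mult_right_zero)

instance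
  by (standard; transfer; simp add: fun_eq_iff algebra_simps)

end

instantiation c0 :: "{ordered_real_vector, lattice_ab_group_add_abs}"
begin

lift_definition less_eq_c0 :: "c0 \<Rightarrow> c0 \<Rightarrow> bool" is "\<lambda>x y. \<forall>n. x n \<le> y n" .
definition less_c0 :: "c0 \<Rightarrow> c0 \<Rightarrow> bool" where "less_c0 x y \<longleftrightarrow> x \<le> y \<and> \<not> y \<le> x"
lift_definition sup_c0 :: "c0 \<Rightarrow> c0 \<Rightarrow> c0" is "\<lambda>x y n. max (x n) (y n)"
  by (drule (1) tendsto_max) simp
lift_definition inf_c0 :: "c0 \<Rightarrow> c0 \<Rightarrow> c0" is "\<lambda>x y n. min (x n) (y n)"
  by (drule (1) tendsto_min) simp
lift_definition abs_c0 :: "c0 \<Rightarrow> c0" is "\<lambda>x n. \<bar>x n\<bar>"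
  by (rule tendsto_rabs_zero)

instance
proof
  fix x y z :: c0 and a b :: real
  show "x < y \<longleftrightarrow> x \<le> y \<and> \<not> y \<le> x" by (rule less_c0_def)
  show "x \<le> x" by transfer simp
  show "x \<le> y \<Longrightarrow> y \<le> z \<Longrightarrow> x \<le> z" by transfer (meson order_trans)
  show "x \<le> y \<Longrightarrow> y \<le> x \<Longrightarrow> x = y" by transfer (simp add: fun_eq_iff order_antisym)
  show "x \<le> y \<Longrightarrow> z + x \<le> z + y" by transfer simp
  show "x \<le> y \<Longrightarrow> 0 \<le> a \<Longrightarrow> a *\<^sub>R x \<le> a *\<^sub>R y" by transfer (simp add: mult_left_mono)
  show "a \<le> b \<Longrightarrow> 0 \<le> x \<Longrightarrow> a *\<^sub>R x \<le> b *\<^sub>R x" by transfer (simp add: mult_right_mono)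
  show "inf x y \<le> x" "inf x y \<le> y" by (transfer; simp)+
  show "x \<le> y \<Longrightarrow> x \<le> z \<Longrightarrow> x \<le> inf y z" by transfer simp
  show "x \<le> sup x y" "y \<le> sup x y" by (transfer; simp)+
  show "y \<le> x \<Longrightarrow> z \<le> x \<Longrightarrow> sup y z \<le> x" by transfer simp
  show "\<bar>x\<bar> = sup x (- x)" by transfer (simp add: fun_eq_iff abs_if max_def)
qed

end

instantiation c0 :: real_normed_vector
begin

definition norm_c0 :: "c0 \<Rightarrow> real" where "norm_c0 x = (SUP n. \<bar>c0_nth x n\<bar>)"
definition dist_c0 :: "c0 \<Rightarrow> c0 \<Rightarrow> real" where "dist_c0 x y = norm (x - y)"
definition sgn_c0 :: "c0 \<Rightarrow> c0" where "sgn_c0 x = inverse (norm x) *\<^sub>R x"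
definition uniformity_c0 :: "(c0 \<times> c0) filter"
  where "uniformity_c0 = (INF e\<in>{0<..}. principal {(x, y). dist x y < e})"
definition open_c0 :: "c0 set \<Rightarrow> bool"
  where "open_c0 S = (\<forall>x\<in>S. \<forall>\<^sub>F (x', y) in uniformity. x' = x \<longrightarrow> y \<in> S)"

lemma c0_nth_le_norm: "\<bar>c0_nth x n\<bar> \<le> norm x"
proof -
  have "bounded (range (c0_nth x))"
    using c0_nth_tendsto[of x] by (intro convergent_imp_bounded) (auto simp: convergent_def)
  then have "bdd_above (range (\<lambda>n. \<bar>c0_nth x n\<bar>))"
    by (force simp: bounded_iff bdd_above_def)
  then show ?thesis
    unfolding norm_c0_def by (rule cSUP_upper[OF UNIV_I])
qed

lemma norm_c0_le: "(\<And>n. \<bar>c0_nth x n\<bar> \<le> b) \<Longrightarrow> norm x \<le> b"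
  unfolding norm_c0_def by (rule cSUP_least) auto

instance
proof
  fix x y :: c0 and a :: real
  show "dist x y = norm (x - y)" by (rule dist_c0_def)
  show "sgn x = inverse (norm x) *\<^sub>R x" by (rule sgn_c0_def)
  show "uniformity = (INF e\<in>{0<..}. principal {(x, y::c0). dist x y < e})"
    by (rule uniformity_c0_def)
  show "open U = (\<forall>x\<in>U. \<forall>\<^sub>F (x', y) in uniformity. x' = x \<longrightarrow> y \<in> U)" for U :: "c0 set"
    by (rule open_c0_def)
  show "norm x = 0 \<longleftrightarrow> x = 0"
  proof
    assume "norm x = 0"
    then have "c0_nth x n = 0" for n using c0_nth_le_norm[of x n] by simp
    then show "x = 0" by (intro c0_eqI) (simp add: zero_c0.rep_eq)
  qed (simp add: norm_c0_def zero_c0.rep_eq)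
  show "norm (x + y) \<le> norm x + norm y"
  proof (rule norm_c0_le)
    fix n
    show "\<bar>c0_nth (x + y) n\<bar> \<le> norm x + norm y"
      using c0_nth_le_norm[of x n] c0_nth_le_norm[of y n] by (simp add: plus_c0.rep_eq)
  qed
  have le: "norm (r *\<^sub>R z) \<le> \<bar>r\<bar> * norm z" for r and z :: c0
    by (rule norm_c0_le) (simp add: scaleR_c0.rep_eq abs_mult mult_left_mono c0_nth_le_norm)
  show "norm (a *\<^sub>R x) = \<bar>a\<bar> * norm x"
  proof (cases "a = 0")
    case True
    then show ?thesis by (simp add: norm_c0_def zero_c0.rep_eq)
  next
    case False
    then have "norm x \<le> \<bar>inverse a\<bar> * norm (a *\<^sub>R x)"
      using le[of "inverse a" "a *\<^sub>R x"] by simp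
    with False have "\<bar>a\<bar> * norm x \<le> norm (a *\<^sub>R x)"
      by (simp add: field_simps)
    with le[of a x] show ?thesis by simp
  qed
qed

end

instance c0 :: banach
proof
  fix X :: "nat \<Rightarrow> c0"
  assume X: "Cauchy X"
  have diff: "\<bar>c0_nth x n - c0_nth y n\<bar> \<le> dist x y" for x y n
    using c0_nth_le_norm[of "x - y" n] by (simp add: dist_c0_def minus_c0.rep_eq)
  have "Cauchy (\<lambda>k. c0_nth (X k) n)" for n
  proof (rule metric_CauchyI)
    fix e :: real assume "0 < e"
    then obtain M where "\<forall>i\<ge>M. \<forall>j\<ge>M. dist (X i) (X j) < e"
      using metric_CauchyD[OF X] by blast
    then show "\<exists>M. \<forall>i\<ge>M. \<forall>j\<ge>M. dist (c0_nth (X i) n) (c0_nth (X j) n) < e"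
      unfolding dist_real_def by (meson diff le_less_trans)
  qed
  then obtain g where g: "\<And>n. (\<lambda>k. c0_nth (X k) n) \<longlonglongrightarrow> g n"
    unfolding Cauchy_convergent_iff convergent_def by metis
  have unif: "\<exists>M. \<forall>i\<ge>M. \<forall>n. \<bar>c0_nth (X i) n - g n\<bar> \<le> e" if "0 < e" for e
  proof -
    from that obtain M where M: "\<forall>i\<ge>M. \<forall>j\<ge>M. dist (X i) (X j) < e"
      using metric_CauchyD[OF X] by blast
    have "\<bar>c0_nth (X i) n - g n\<bar> \<le> e" if "i \<ge> M" for i n
    proof (rule tendsto_upperbound)
      show "(\<lambda>j. \<bar>c0_nth (X i) n - c0_nth (X j) n\<bar>) \<longlonglongrightarrow> \<bar>c0_nth (X i) n - g n\<bar>"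
        by (intro tendsto_intros g)
      show "\<forall>\<^sub>F j in sequentially. \<bar>c0_nth (X i) n - c0_nth (X j) n\<bar> \<le> e"
        using M that diff
        by (intro eventually_sequentiallyI[of M]) (meson le_less_trans less_imp_le)
    qed simp
    then show ?thesis by blast
  qed
  have "g \<longlonglongrightarrow> 0"
  proof (rule LIMSEQ_I)
    fix e :: real assume "0 < e"
    then obtain M where M: "\<And>n. \<bar>c0_nth (X M) n - g n\<bar> \<le> e / 2"
      using unif[of "e / 2"] by auto
    obtain N where N: "\<And>n. n \<ge> N \<Longrightarrow> \<bar>c0_nth (X M) n\<bar> < e / 2"
      using LIMSEQ_D[OF c0_nth_tendsto[of "X M"], of "e / 2"] \<open>0 < e\<close> by auto
    have "norm (g n - 0) < e" if "n \<ge> N" for n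
      using M[of n] N[OF that] unfolding real_norm_def by linarith
    then show "\<exists>N. \<forall>n\<ge>N. norm (g n - 0) < e" by blast
  qed
  then have G: "c0_nth (Abs_c0 g) = g" by (simp add: Abs_c0_inverse)
  have "X \<longlonglongrightarrow> Abs_c0 g"
  proof (rule metric_LIMSEQ_I)
    fix e :: real assume "0 < e"
    then obtain M where M: "\<And>i n. i \<ge> M \<Longrightarrow> \<bar>c0_nth (X i) n - g n\<bar> \<le> e / 2"
      using unif[of "e / 2"] by auto
    have le: "dist (X i) (Abs_c0 g) \<le> e / 2" if "i \<ge> M" for i
      unfolding dist_c0_def using M[OF that]
      by (intro norm_c0_le) (simp add: minus_c0.rep_eq G)
    have "dist (X i) (Abs_c0 g) < e" if "i \<ge> M" for i
      using le[OF that] \<open>0 < e\<close> by linarith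
    then show "\<exists>M. \<forall>i\<ge>M. dist (X i) (Abs_c0 g) < e" by blast
  qed
  then show "convergent X" by (auto simp: convergent_def)
qed

instance c0 :: banach_lattice
proof
  fix x y :: c0
  assume "\<bar>x\<bar> \<le> \<bar>y\<bar>"
  then have "\<bar>c0_nth x n\<bar> \<le> \<bar>c0_nth y n\<bar>" for n by transfer simp
  then show "norm x \<le> norm y"
    by (meson c0_nth_le_norm norm_c0_le order_trans)
qed

subsection \<open>Isomorphisms and sublattices\<close>

definition order_isomorphism :: "'a::order set \<Rightarrow> 'b::order set \<Rightarrow> ('a \<Rightarrow> 'b) \<Rightarrow> bool" where
  "order_isomorphism A B T \<longleftrightarrow>
     bij_betw T A B \<and> (\<forall>x\<in>A. \<forall>y\<in>A. x \<ge> y \<longleftrightarrow> T x \<ge> T y)"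

definition order_isomorphic :: "'a::order set \<Rightarrow> 'b::order set \<Rightarrow> bool" where
  "order_isomorphic A B \<longleftrightarrow> (\<exists>T. order_isomorphism A B T)"

definition lattice_isomorphism :: "('a::banach_lattice \<Rightarrow> 'b::banach_lattice) \<Rightarrow> bool" where
  "lattice_isomorphism T \<longleftrightarrow> linear T \<and> bij T \<and> (\<forall>x. T \<bar>x\<bar> = \<bar>T x\<bar>)"

definition sublattice :: "'a::banach_lattice set \<Rightarrow> bool" where
  "sublattice S \<longleftrightarrow> subspace S \<and> (\<forall>x\<in>S. \<forall>y\<in>S. sup x y \<in> S \<and> inf x y \<in> S)"

definition infinite_dimensional :: "'a::real_vector set \<Rightarrow> bool" where
  "infinite_dimensional S \<longleftrightarrow> \<not> (\<exists>B. finite B \<and> S \<subseteq> span B)"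

end

theory Submission
  imports Defs
begin

text \<open>
  An order isomorphism \<open>U\<close> from \<open>E\<close> onto \<open>c0\<close> with \<open>U 0 = 0\<close> carries order intervals that are chains to
  order intervals that are chains, so the preimages \<open>b\<^sub>k\<close> of the unit vectors are atoms of \<open>E\<close> and have
  linear coordinate functionals \<open>f\<^sub>k\<close>. Since \<open>c0\<close> is complete, the inverse of \<open>U\<close> is bounded on the
  positive elements below some level \<open>\<epsilon> < 1\<close>. Let \<open>w\<^sub>k b\<^sub>k\<close> be the preimage of \<open>\<epsilon>\<close> times the \<open>k\<close>-th
  unit vector. The finite sums of the \<open>w\<^sub>k b\<^sub>k\<close> are then uniformly bounded in norm, so that
  \<open>\<Sum>k. y\<^sub>k w\<^sub>k b\<^sub>k\<close> converges for every null sequence \<open>y\<close>; conversely \<open>f\<^sub>k x / w\<^sub>k\<close> is a null sequence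
  because \<open>U (N \<bar>x\<bar>)\<close> is eventually below \<open>\<epsilon>\<close> for every \<open>N\<close>. Hence \<open>x \<mapsto> (f\<^sub>k x / w\<^sub>k)\<^sub>k\<close> is a lattice
  isomorphism. A closed sublattice of \<open>c0\<close> is generated by pairwise disjoint atoms of norm one, and
  evaluating at points where these attain their norms identifies it with \<open>c0\<close>.
\<close>

section \<open>The sequence space\<close>

lemmas c0_nth_simps = zero_c0.rep_eq plus_c0.rep_eq uminus_c0.rep_eq minus_c0.rep_eq
  scaleR_c0.rep_eq sup_c0.rep_eq inf_c0.rep_eq abs_c0.rep_eq

lemma bounded_linear_c0_nth: "bounded_linear (\<lambda>x. c0_nth x n)"
  by (rule bounded_linear_intro[where K = 1])
    (simp_all add: c0_nth_simps c0_nth_le_norm)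

lemma c0_nth_sum: "c0_nth (sum f A) n = (\<Sum>a\<in>A. c0_nth (f a) n)"
  by (rule linear_sum[OF bounded_linear.linear[OF bounded_linear_c0_nth]])

text \<open>For nonzero \<open>x\<close> the tail stays below half the norm, so the supremum is a
  maximum over a finite initial segment. Peaks of atoms are found this way.\<close>

lemma c0_norm_attained: "\<exists>n. \<bar>c0_nth x n\<bar> = norm x"
proof (cases "x = 0")
  case True
  then show ?thesis by (simp add: zero_c0.rep_eq)
next
  case False
  then have pos: "0 < norm x" by simp
  then obtain N where N: "\<And>n. n \<ge> N \<Longrightarrow> \<bar>c0_nth x n\<bar> < norm x / 2"
    using LIMSEQ_D[OF c0_nth_tendsto[of x], of "norm x / 2"] by auto
  let ?M = "Max ((\<lambda>n. \<bar>c0_nth x n\<bar>) ` {..N})"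
  have "\<bar>c0_nth x n\<bar> \<le> max ?M (norm x / 2)" for n
  proof (cases "n \<le> N")
    case True
    then have "\<bar>c0_nth x n\<bar> \<le> ?M" by (intro Max_ge) auto
    then show ?thesis by simp
  next
    case False
    then show ?thesis using N[of n] by simp
  qed
  then have "norm x \<le> max ?M (norm x / 2)" by (rule norm_c0_le)
  then have "norm x \<le> ?M" using pos by (simp add: max_def split: if_splits)
  moreover have "?M \<in> (\<lambda>n. \<bar>c0_nth x n\<bar>) ` {..N}" by (rule Max_in) auto
  then obtain n where "?M = \<bar>c0_nth x n\<bar>" by (rule imageE)
  ultimately show ?thesis using c0_nth_le_norm[of x n] by (intro exI[of _ n]) simp
qed

lift_definition c0_unit :: "nat \<Rightarrow> c0" is "\<lambda>k n. if n = k then 1 else 0"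
proof -
  fix k :: nat
  have "\<forall>\<^sub>F n in sequentially. (if n = k then 1 else 0) = (0::real)"
    by (rule eventually_sequentiallyI[of "Suc k"]) auto
  then show "(\<lambda>n. if n = k then 1 else 0) \<longlonglongrightarrow> (0::real)"
    by (rule tendsto_eventually)
qed

lemma below_c0_unit:
  assumes "0 \<le> y" "y \<le> c0_unit k"
  obtains r where "0 \<le> r" "r \<le> 1" "y = r *\<^sub>R c0_unit k"
proof
  have y: "0 \<le> c0_nth y n" "c0_nth y n \<le> (if n = k then 1 else 0)" for n
    using assms by (simp_all add: less_eq_c0.rep_eq c0_unit.rep_eq zero_c0.rep_eq)
  show "0 \<le> c0_nth y k" "c0_nth y k \<le> 1" using y[of k] by simp_all
  show "y = c0_nth y k *\<^sub>R c0_unit k"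
  proof (rule c0_eqI)
    fix n
    show "c0_nth y n = c0_nth (c0_nth y k *\<^sub>R c0_unit k) n"
      using y[of n] by (cases "n = k") (simp_all add: scaleR_c0.rep_eq c0_unit.rep_eq)
  qed
qed

text \<open>Describes the coordinates of a positive element by order alone, in a form that an order
  isomorphism can transport.\<close>

lemma scaleR_c0_unit_le_iff:
  assumes "0 \<le> y"
  shows "r *\<^sub>R c0_unit k \<le> y \<longleftrightarrow> r \<le> c0_nth y k"
  using assms by (auto simp: less_eq_c0.rep_eq c0_unit.rep_eq c0_nth_simps split: if_splits)

text \<open>The unit vectors are independent, since the \<open>k\<close>-th coordinate vanishes on
  all of them but the \<open>k\<close>-th. Hence \<open>c0\<close> itself qualifies as the
  sublattice in the third condition.\<close>

lemma infinite_dimensional_c0: "infinite_dimensional (UNIV :: c0 set)"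
proof -
  have inj: "inj c0_unit"
  proof (rule injI)
    fix j k assume "c0_unit j = c0_unit k"
    then have "c0_nth (c0_unit j) j = c0_nth (c0_unit k) j" by simp
    then show "j = k" by (simp add: c0_unit.rep_eq split: if_splits)
  qed
  have "c0_unit k \<notin> span (range c0_unit - {c0_unit k})" for k
  proof
    assume "c0_unit k \<in> span (range c0_unit - {c0_unit k})"
    also have "\<dots> \<subseteq> {x. c0_nth x k = 0}"
    proof (rule span_minimal)
      show "range c0_unit - {c0_unit k} \<subseteq> {x. c0_nth x k = 0}"
        by (auto simp: c0_unit.rep_eq)
      show "subspace {x. c0_nth x k = 0}"
        by (simp add: subspace_def c0_nth_simps)
    qed
    finally show False by (simp add: c0_unit.rep_eq)
  qed
  then have "independent (range c0_unit)"
    by (auto simp: dependent_def)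
  moreover have "infinite (range c0_unit)"
    using inj by (simp add: finite_image_iff)
  ultimately show ?thesis
    unfolding infinite_dimensional_def
    using independent_span_bound by (metis subset_UNIV top.extremum_uniqueI)
qed

section \<open>Atoms and their coordinate functionals in Banach lattices\<close>

lemma norm_mono_nonneg:
  fixes x y :: "'a::banach_lattice"
  assumes "0 \<le> x" "x \<le> y"
  shows "norm x \<le> norm y"
  using assms by (intro norm_mono_abs) simp

text \<open>The positive part of \<open>x\<close> lies between 0 and every
  \<open>e *\<^sub>R b\<close>, so monotonicity of the norm makes it vanish.\<close>

lemma archimedean_le_zero:
  fixes x b :: "'a::banach_lattice"
  assumes "0 \<le> b" and le: "\<And>e. 0 < e \<Longrightarrow> x \<le> e *\<^sub>R b"
  shows "x \<le> 0"
proof -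
  have "norm (pprt x) \<le> 0 + e" if "0 < e" for e
  proof -
    let ?d = "e / (norm b + 1)"
    have "0 < norm b + 1" by (smt (verit) norm_ge_zero)
    then have d: "0 < ?d" using that by simp
    have "pprt x \<le> ?d *\<^sub>R b"
      unfolding pprt_def using le[OF d] \<open>0 \<le> b\<close> d by (simp add: scaleR_nonneg_nonneg)
    then have "norm (pprt x) \<le> norm (?d *\<^sub>R b)" by (intro norm_mono_nonneg) simp_all
    also have "\<dots> = ?d * norm b" unfolding norm_scaleR using d by (simp only: abs_of_pos)
    also have "\<dots> \<le> e" using that \<open>0 < norm b + 1\<close> by (simp add: field_simps)
    finally show ?thesis by simp
  qed
  then have "norm (pprt x) \<le> 0" by (rule field_le_epsilon)
  then have "pprt x = 0" by simp
  then show ?thesis by (simp add: pprt_def sup_absorb2 le_iff_sup)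
qed

lemma scaleR_le_scaleR_iff:
  fixes b :: "'a::banach_lattice"
  assumes "0 < b"
  shows "r *\<^sub>R b \<le> s *\<^sub>R b \<longleftrightarrow> r \<le> s"
proof
  assume le: "r *\<^sub>R b \<le> s *\<^sub>R b"
  show "r \<le> s"
  proof (rule ccontr)
    assume "\<not> r \<le> s"
    then have "s *\<^sub>R b \<le> r *\<^sub>R b" using assms by (intro scaleR_right_mono) simp_all
    then have "s *\<^sub>R b = r *\<^sub>R b" using le by (rule antisym)
    with \<open>\<not> r \<le> s\<close> assms show False by auto
  qed
qed (use assms in \<open>simp add: scaleR_right_mono\<close>)

text \<open>Phrased by order alone, so that it passes through nonlinear order isomorphisms fixing 0;
  \<open>atom_multiple\<close> recovers the linear description.\<close>

definition atom :: "'a::banach_lattice \<Rightarrow> bool" where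
  "atom b \<longleftrightarrow> 0 < b \<and> (\<forall>u\<in>{0..b}. \<forall>v\<in>{0..b}. u \<le> v \<or> v \<le> u)"

text \<open>The coefficient is the supremum of all \<open>l\<close> with
  \<open>l *\<^sub>R b\<close> below \<open>u\<close>. Since \<open>[0, b]\<close> is a chain, any
  larger multiple lies above \<open>u\<close>, and the Archimedean property closes the gap from both
  sides.\<close>

lemma atom_multiple:
  assumes "atom b" "0 \<le> u" "u \<le> b"
  obtains m where "0 \<le> m" "m \<le> 1" "u = m *\<^sub>R b"
proof -
  define L where "L = {l. 0 \<le> l \<and> l \<le> 1 \<and> l *\<^sub>R b \<le> u}"
  have b: "0 < b" using assms by (simp add: atom_def)
  have zero: "0 \<in> L" using assms by (simp add: L_def)
  then have ne: "L \<noteq> {}" by blast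
  have bdd: "bdd_above L" by (auto simp: L_def intro: bdd_aboveI[of _ 1])
  have m0: "0 \<le> Sup L" using zero bdd by (rule cSup_upper)
  have m1: "Sup L \<le> 1" using ne by (intro cSup_least) (auto simp: L_def)
  have "u - Sup L *\<^sub>R b \<le> e *\<^sub>R b" if "0 < e" for e
  proof -
    have "u \<le> (Sup L + e) *\<^sub>R b"
    proof (cases "Sup L + e \<le> 1")
      case True
      have "Sup L + e \<notin> L" using cSup_upper[OF _ bdd, of "Sup L + e"] that by auto
      then have n: "\<not> (Sup L + e) *\<^sub>R b \<le> u" using True m0 that by (simp add: L_def)
      have "(Sup L + e) *\<^sub>R b \<in> {0..b}"
        using b m0 that True scaleR_le_scaleR_iff[OF b, of "Sup L + e" 1]
        by (simp add: scaleR_nonneg_nonneg)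
      moreover have "u \<in> {0..b}" using assms by simp
      ultimately show ?thesis using n \<open>atom b\<close> unfolding atom_def by blast
    next
      case False
      then have "1 *\<^sub>R b \<le> (Sup L + e) *\<^sub>R b" using b by (intro scaleR_right_mono) simp_all
      then show ?thesis using assms by simp
    qed
    then show ?thesis by (simp add: algebra_simps)
  qed
  then have "u - Sup L *\<^sub>R b \<le> 0" using b by (intro archimedean_le_zero[of b]) simp_all
  moreover have "Sup L *\<^sub>R b - u \<le> e *\<^sub>R b" if "0 < e" for e
  proof -
    obtain l where "l \<in> L" "Sup L - e < l"
      using less_cSupD[OF ne, of "Sup L - e"] \<open>0 < e\<close> by auto
    then have "(Sup L - e) *\<^sub>R b \<le> l *\<^sub>R b" "l *\<^sub>R b \<le> u"
      using b by (auto simp: L_def scaleR_right_mono)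
    then have "(Sup L - e) *\<^sub>R b \<le> u" by simp
    then show ?thesis by (simp add: algebra_simps)
  qed
  then have "Sup L *\<^sub>R b - u \<le> 0" using b by (intro archimedean_le_zero[of b]) simp_all
  ultimately have "u = Sup L *\<^sub>R b" by simp
  with m0 m1 show ?thesis by (rule that)
qed

text \<open>For \<open>0 < b\<close> and \<open>0 \<le> x\<close> this supremum is a maximum, by
  \<open>cone_coord_scaleR_le\<close>; for an atom \<open>b\<close> it is the coefficient of
  \<open>x\<close> along \<open>b\<close>. It is meant for the positive cone, and
  \<open>coord\<close> extends it to the whole space.\<close>

definition cone_coord :: "'a::banach_lattice \<Rightarrow> 'a \<Rightarrow> real" where
  "cone_coord b x = Sup {l. 0 \<le> l \<and> l *\<^sub>R b \<le> x}"

lemma scaleR_le_imp_norm_le: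
  fixes b x :: "'a::banach_lattice"
  assumes "0 < b" "0 \<le> l" "l *\<^sub>R b \<le> x"
  shows "l \<le> norm x / norm b"
proof -
  have "norm (l *\<^sub>R b) \<le> norm x"
    using assms by (intro norm_mono_nonneg) (simp_all add: scaleR_nonneg_nonneg)
  then show ?thesis using assms by (simp add: field_simps)
qed

lemma cone_coord_ge:
  assumes "0 < b" "0 \<le> l" "l *\<^sub>R b \<le> x"
  shows "l \<le> cone_coord b x"
  unfolding cone_coord_def
proof (rule cSup_upper)
  show "bdd_above {l. 0 \<le> l \<and> l *\<^sub>R b \<le> x}"
    using scaleR_le_imp_norm_le[OF \<open>0 < b\<close>] by (intro bdd_aboveI[of _ "norm x / norm b"]) auto
qed (use assms in simp)

lemma cone_coord_le:
  assumes "0 \<le> x" "\<And>l. 0 \<le> l \<Longrightarrow> l *\<^sub>R b \<le> x \<Longrightarrow> l \<le> c"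
  shows "cone_coord b x \<le> c"
  unfolding cone_coord_def
proof (rule cSup_least)
  show "{l. 0 \<le> l \<and> l *\<^sub>R b \<le> x} \<noteq> {}" using assms(1) by (auto intro!: exI[of _ 0])
qed (use assms in auto)

lemma cone_coord_nonneg: "0 < b \<Longrightarrow> 0 \<le> x \<Longrightarrow> 0 \<le> cone_coord b x"
  by (rule cone_coord_ge) simp_all

lemma cone_coord_scaleR_le:
  assumes "0 < b" "0 \<le> x"
  shows "cone_coord b x *\<^sub>R b \<le> x"
proof -
  have "cone_coord b x *\<^sub>R b - x \<le> e *\<^sub>R b" if "0 < e" for e
  proof -
    have "\<not> cone_coord b x \<le> cone_coord b x - e" using that by simp
    then obtain l where "0 \<le> l" "l *\<^sub>R b \<le> x" "\<not> l \<le> cone_coord b x - e"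
      using cone_coord_le[OF \<open>0 \<le> x\<close>, of b "cone_coord b x - e"] by blast
    then have "(cone_coord b x - e) *\<^sub>R b \<le> l *\<^sub>R b" "l *\<^sub>R b \<le> x"
      using assms by (auto simp: scaleR_right_mono)
    then have "(cone_coord b x - e) *\<^sub>R b \<le> x" by simp
    then show ?thesis by (simp add: algebra_simps)
  qed
  then have "cone_coord b x *\<^sub>R b - x \<le> 0" using assms by (intro archimedean_le_zero[of b]) simp_all
  then show ?thesis by simp
qed

text \<open>Superadditivity holds because the suprema are attained. For subadditivity a multiple of
  \<open>b\<close> below \<open>x + y\<close> is split into a part below \<open>x\<close> and a part
  below \<open>y\<close>, both multiples of \<open>b\<close> because \<open>b\<close> is an
  atom.\<close>

lemma cone_coord_add:
  assumes "atom b" "0 \<le> x" "0 \<le> y"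
  shows "cone_coord b (x + y) = cone_coord b x + cone_coord b y"
proof (rule antisym)
  have b: "0 < b" using assms by (simp add: atom_def)
  show "cone_coord b x + cone_coord b y \<le> cone_coord b (x + y)"
  proof (rule cone_coord_ge[OF b])
    show "0 \<le> cone_coord b x + cone_coord b y" using assms b by (simp add: cone_coord_nonneg)
    show "(cone_coord b x + cone_coord b y) *\<^sub>R b \<le> x + y"
      unfolding scaleR_add_left using assms b by (intro add_mono cone_coord_scaleR_le)
  qed
  show "cone_coord b (x + y) \<le> cone_coord b x + cone_coord b y"
  proof (rule cone_coord_le)
    fix l assume l: "0 \<le> l" "l *\<^sub>R b \<le> x + y"
    show "l \<le> cone_coord b x + cone_coord b y"
    proof (cases "l = 0")
      case True
      then show ?thesis using assms b by (simp add: cone_coord_nonneg)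
    next
      case False
      with l have l0: "0 < l" by simp
      \<comment> \<open>Riesz decomposition of \<open>b \<le> x / l + y / l\<close>\<close>
      define u where "u = inf b (inverse l *\<^sub>R x)"
      have "0 \<le> u" "u \<le> b" using b l0 assms by (simp_all add: u_def scaleR_nonneg_nonneg)
      then obtain m where m: "0 \<le> m" "m \<le> 1" "u = m *\<^sub>R b"
        using atom_multiple[OF \<open>atom b\<close>] by metis
      have "l *\<^sub>R u \<le> l *\<^sub>R (inverse l *\<^sub>R x)" using l0 by (intro scaleR_left_mono) (simp_all add: u_def)
      then have "l * m \<le> cone_coord b x" using l0 m by (intro cone_coord_ge[OF b]) simp_all
      moreover have "b - inverse l *\<^sub>R y \<le> u"
      proof -
        have "inverse l *\<^sub>R (l *\<^sub>R b) \<le> inverse l *\<^sub>R (x + y)"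
          using l l0 by (intro scaleR_left_mono) simp_all
        then have "b \<le> inverse l *\<^sub>R x + inverse l *\<^sub>R y" using l0 by (simp add: scaleR_add_right)
        moreover have "0 \<le> inverse l *\<^sub>R y" using l0 assms by (simp add: scaleR_nonneg_nonneg)
        ultimately show ?thesis by (simp add: u_def algebra_simps)
      qed
      then have "l *\<^sub>R (b - u) \<le> l *\<^sub>R (inverse l *\<^sub>R y)"
        using l0 by (intro scaleR_left_mono) (simp_all add: algebra_simps)
      then have "(l * (1 - m)) *\<^sub>R b \<le> y" using l0 m by (simp add: algebra_simps)
      then have "l * (1 - m) \<le> cone_coord b y" using l0 m by (intro cone_coord_ge[OF b]) simp_all
      ultimately show ?thesis by (simp add: algebra_simps)
    qed
  qed (use assms in simp)
qed

text \<open>One inequality holds for every positive factor; applied to the inverse factor it yields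
  the other.\<close>

lemma cone_coord_scaleR:
  assumes "0 < b" "0 \<le> x" "0 \<le> c"
  shows "cone_coord b (c *\<^sub>R x) = c * cone_coord b x"
proof (cases "c = 0")
  case True
  have "l \<le> 0" if "l *\<^sub>R b \<le> 0" for l
    using that scaleR_le_scaleR_iff[OF \<open>0 < b\<close>, of l 0] by simp
  then have "cone_coord b 0 \<le> 0" by (intro cone_coord_le) auto
  with cone_coord_nonneg[OF \<open>0 < b\<close>, of 0] True show ?thesis by simp
next
  case False
  with assms have c: "0 < c" by simp
  have ge: "d * cone_coord b z \<le> cone_coord b (d *\<^sub>R z)" if "0 < d" "0 \<le> z" for d z
  proof (rule cone_coord_ge[OF \<open>0 < b\<close>])
    show "0 \<le> d * cone_coord b z" using that assms by (simp add: cone_coord_nonneg)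
    have "d *\<^sub>R (cone_coord b z *\<^sub>R b) \<le> d *\<^sub>R z"
      using that assms by (intro scaleR_left_mono cone_coord_scaleR_le) simp_all
    then show "(d * cone_coord b z) *\<^sub>R b \<le> d *\<^sub>R z" by simp
  qed
  have "inverse c * cone_coord b (c *\<^sub>R x) \<le> cone_coord b x"
    using ge[of "inverse c" "c *\<^sub>R x"] c assms by (simp add: scaleR_nonneg_nonneg)
  then have "cone_coord b (c *\<^sub>R x) \<le> c * cone_coord b x" using c by (simp add: field_simps)
  with ge[OF c \<open>0 \<le> x\<close>] show ?thesis by simp
qed

text \<open>\<open>nprt x\<close> is the infimum of \<open>x\<close> and 0, so the negative part of
  \<open>x\<close> is \<open>- nprt x\<close>.\<close>

definition coord :: "'a::banach_lattice \<Rightarrow> 'a \<Rightarrow> real" where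
  "coord b x = cone_coord b (pprt x) - cone_coord b (- nprt x)"

text \<open>By additivity on the cone the value does not depend on how an element is written as a
  difference of positive ones; linearity follows from this.\<close>

lemma coord_diff_nonneg:
  assumes "atom b" "0 \<le> u" "0 \<le> v"
  shows "coord b (u - v) = cone_coord b u - cone_coord b v"
proof -
  have "pprt (u - v) + v = - nprt (u - v) + u"
    using prts[of "u - v"] by (simp add: algebra_simps)
  then have "cone_coord b (pprt (u - v) + v) = cone_coord b (- nprt (u - v) + u)" by (rule arg_cong)
  moreover have "0 \<le> - nprt (u - v)" "0 \<le> pprt (u - v)" by simp_all
  ultimately show ?thesis using assms by (simp only: cone_coord_add coord_def)
qed

lemma coord_nonneg_eq:
  assumes "atom b" "0 \<le> x"
  shows "coord b x = cone_coord b x"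
  using coord_diff_nonneg[OF assms, of 0] cone_coord_scaleR[of b 0 0] assms by (simp add: atom_def)

lemma linear_coord:
  assumes "atom b"
  shows "linear (coord b)"
proof (rule linearI)
  have b: "0 < b" using assms by (simp add: atom_def)
  fix x y :: 'a and c :: real
  have "x + y = (pprt x + pprt y) - (- nprt x + - nprt y)"
    by (subst (1) prts[of x], subst (1) prts[of y]) (simp add: algebra_simps)
  then have "coord b (x + y) = cone_coord b (pprt x + pprt y) - cone_coord b (- nprt x + - nprt y)"
    using assms by (simp only: coord_diff_nonneg add_nonneg_nonneg zero_le_pprt nprt_le_zero neg_0_le_iff_le)
  moreover have "0 \<le> - nprt z" "0 \<le> pprt z" for z :: 'a by simp_all
  ultimately show "coord b (x + y) = coord b x + coord b y"
    using assms by (simp only: cone_coord_add) (simp add: coord_def)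
  show "coord b (c *\<^sub>R x) = c *\<^sub>R coord b x"
  proof (cases "0 \<le> c")
    case True
    have "c *\<^sub>R x = c *\<^sub>R pprt x - c *\<^sub>R (- nprt x)"
      by (subst (1) prts[of x]) (simp add: algebra_simps)
    then have "coord b (c *\<^sub>R x) = cone_coord b (c *\<^sub>R pprt x) - cone_coord b (c *\<^sub>R (- nprt x))"
      using assms True by (simp only: coord_diff_nonneg scaleR_nonneg_nonneg zero_le_pprt nprt_le_zero neg_0_le_iff_le)
    also have "\<dots> = c * cone_coord b (pprt x) - c * cone_coord b (- nprt x)"
      using b True by (simp only: cone_coord_scaleR zero_le_pprt nprt_le_zero neg_0_le_iff_le)
    finally show ?thesis by (simp add: coord_def algebra_simps)
  next
    case False
    then have c: "0 \<le> - c" by simp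
    have "c *\<^sub>R x = (- c) *\<^sub>R (- nprt x) - (- c) *\<^sub>R pprt x"
      by (subst (1) prts[of x]) (simp add: algebra_simps)
    then have "coord b (c *\<^sub>R x) = cone_coord b ((- c) *\<^sub>R (- nprt x)) - cone_coord b ((- c) *\<^sub>R pprt x)"
      using assms c by (simp only: coord_diff_nonneg scaleR_nonneg_nonneg zero_le_pprt nprt_le_zero neg_0_le_iff_le)
    also have "\<dots> = (- c) * cone_coord b (- nprt x) - (- c) * cone_coord b (pprt x)"
      using b c by (simp only: cone_coord_scaleR zero_le_pprt nprt_le_zero neg_0_le_iff_le)
    finally show ?thesis by (simp add: coord_def algebra_simps)
  qed
qed

text \<open>The positive and negative parts of \<open>x\<close> are disjoint, so they cannot both
  dominate a positive multiple of \<open>b\<close>: one of the two coefficients is 0.\<close>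

lemma coord_abs:
  assumes "atom b"
  shows "coord b \<bar>x\<bar> = \<bar>coord b x\<bar>"
proof -
  have b: "0 < b" using assms by (simp add: atom_def)
  define p q where "p = cone_coord b (pprt x)" and "q = cone_coord b (- nprt x)"
  have pq: "0 \<le> p" "0 \<le> q" using b by (simp_all add: p_def q_def cone_coord_nonneg)
  let ?z = "min p q *\<^sub>R b"
  have "?z \<le> p *\<^sub>R b" "?z \<le> q *\<^sub>R b" using b by (auto intro: scaleR_right_mono)
  then have z: "?z \<le> pprt x" "?z \<le> - nprt x"
    using b cone_coord_scaleR_le[of b "pprt x"] cone_coord_scaleR_le[of b "- nprt x"]
    by (auto simp: p_def q_def intro: order_trans)
  \<comment> \<open>Subtracting a common lower bound of both parts from \<open>pprt x\<close> leaves
    an upper bound of \<open>x\<close> and 0, so minimality of \<open>pprt x\<close> forces that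
    lower bound to be at most 0.\<close>
  have "x \<le> pprt x - ?z"
    using add_left_mono[OF z(2), of "nprt x"] by (subst (1) prts[of x]) (simp add: algebra_simps)
  then have "pprt x \<le> pprt x - ?z"
    using z(1) by (subst (1) pprt_def) simp
  then have "?z \<le> 0 *\<^sub>R b" by simp
  then have "min p q \<le> 0" using scaleR_le_scaleR_iff[OF b] by blast
  then have "p = 0 \<or> q = 0" using pq by (auto simp: min_def split: if_splits)
  moreover have "coord b \<bar>x\<bar> = p + q"
    using assms by (simp add: coord_nonneg_eq abs_prts p_def q_def cone_coord_add
        flip: add_uminus_conv_diff)
  moreover have "coord b x = p - q" by (simp add: coord_def p_def q_def)
  ultimately show ?thesis using pq by auto
qed

lemma bounded_linear_coord:
  assumes "atom b"
  shows "bounded_linear (coord b)"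
proof (rule bounded_linear_intro)
  have b: "0 < b" using assms by (simp add: atom_def)
  interpret linear "coord b" using assms by (rule linear_coord)
  show "coord b (x + y) = coord b x + coord b y" "coord b (r *\<^sub>R x) = r *\<^sub>R coord b x" for x y r
    by (rule add, rule scale)
  show "norm (coord b x) \<le> norm x * inverse (norm b)" for x
  proof -
    have "norm (coord b x) = cone_coord b \<bar>x\<bar>"
      using assms by (simp flip: coord_abs add: coord_nonneg_eq)
    also have "\<dots> \<le> norm \<bar>x\<bar> / norm b"
      using b by (intro cone_coord_le scaleR_le_imp_norm_le) simp_all
    also have "norm \<bar>x\<bar> = norm x" by (intro antisym norm_mono_abs) simp_all
    finally show ?thesis by (simp add: field_simps)
  qed
qed

lemma coord_self:
  assumes "atom b"
  shows "coord b b = 1"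
proof -
  have b: "0 < b" using assms by (simp add: atom_def)
  have "cone_coord b b \<le> 1"
    using b scaleR_le_scaleR_iff[OF b, of _ 1] by (intro cone_coord_le) simp_all
  moreover have "1 \<le> cone_coord b b" using b by (intro cone_coord_ge) simp_all
  ultimately show ?thesis using assms b by (simp add: coord_nonneg_eq)
qed

text \<open>If \<open>l *\<^sub>R b\<close> is below \<open>x\<close>, then
  \<open>min 1 l *\<^sub>R b\<close> is below both \<open>b\<close> and \<open>x\<close>, hence
  below 0.\<close>

lemma coord_disjoint:
  assumes "atom b" "0 \<le> x" "inf b x = 0"
  shows "coord b x = 0"
proof -
  have b: "0 < b" using assms by (simp add: atom_def)
  have "l \<le> 0" if "0 \<le> l" "l *\<^sub>R b \<le> x" for l
  proof -
    have "min 1 l *\<^sub>R b \<le> 1 *\<^sub>R b" "min 1 l *\<^sub>R b \<le> l *\<^sub>R b"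
      using b by (simp_all only: scaleR_le_scaleR_iff min.cobounded1 min.cobounded2)
    then have "min 1 l *\<^sub>R b \<le> inf b x" using that by auto
    then have "min 1 l *\<^sub>R b \<le> 0 *\<^sub>R b" using assms by simp
    then have "min 1 l \<le> 0" using scaleR_le_scaleR_iff[OF b] by blast
    then show ?thesis by (simp add: min_def split: if_splits)
  qed
  then have "cone_coord b x \<le> 0" using assms by (intro cone_coord_le)
  with cone_coord_nonneg[OF b \<open>0 \<le> x\<close>] assms show ?thesis by (simp add: coord_nonneg_eq)
qed

text \<open>The modulus of a late block of the series is at most a small multiple of the
  corresponding block of \<open>g\<close>, whose norm is at most \<open>C\<close>. This supplies the
  preimages in both surjectivity arguments below.\<close>

lemma summable_null_scaleR:
  fixes g :: "nat \<Rightarrow> 'a::banach_lattice"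
  assumes y: "y \<longlonglongrightarrow> 0" and g: "\<And>k. 0 \<le> g k"
    and C: "\<And>F. finite F \<Longrightarrow> norm (sum g F) \<le> C"
  shows "summable (\<lambda>k. y k *\<^sub>R g k)"
  unfolding summable_Cauchy
proof (intro allI impI)
  fix e :: real assume e: "0 < e"
  have C0: "0 \<le> C" using C[of "{}"] by simp
  define d where "d = e / (C + 1)"
  have d: "0 < d" using e C0 by (simp add: d_def)
  obtain N where N: "\<And>k. k \<ge> N \<Longrightarrow> \<bar>y k\<bar> < d"
    using LIMSEQ_D[OF y d] by auto
  show "\<exists>N. \<forall>m\<ge>N. \<forall>n. norm (\<Sum>k = m..<n. y k *\<^sub>R g k) < e"
  proof (intro exI[of _ N] allI impI)
    fix m n assume m: "N \<le> m"
    have yd: "y k \<le> d" "- y k \<le> d" if "k \<in> {m..<n}" for k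
      using N[of k] m that by auto
    have "(\<Sum>k = m..<n. y k *\<^sub>R g k) \<le> (\<Sum>k = m..<n. d *\<^sub>R g k)"
      using yd g by (intro sum_mono scaleR_right_mono)
    moreover have "- (\<Sum>k = m..<n. y k *\<^sub>R g k) \<le> (\<Sum>k = m..<n. d *\<^sub>R g k)"
      unfolding sum_negf[symmetric] scaleR_minus_left[symmetric]
      using yd g by (intro sum_mono scaleR_right_mono)
    ultimately have "\<bar>\<Sum>k = m..<n. y k *\<^sub>R g k\<bar> \<le> \<bar>\<Sum>k = m..<n. d *\<^sub>R g k\<bar>"
      by (meson abs_ge_self abs_leI order_trans)
    then have "norm (\<Sum>k = m..<n. y k *\<^sub>R g k) \<le> norm (d *\<^sub>R (\<Sum>k = m..<n. g k))"
      unfolding scaleR_sum_right by (rule norm_mono_abs)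
    also have "\<dots> \<le> d * C" using d C by (simp add: mult_left_mono)
    also have "\<dots> < e" using e C0 by (simp add: d_def field_simps)
    finally show "norm (\<Sum>k = m..<n. y k *\<^sub>R g k) < e" .
  qed
qed

section \<open>Banach lattices order isomorphic to the sequence space\<close>

lemma order_isomorphic_c0_imp_lattice_isomorphic:
  assumes "order_isomorphic (UNIV :: 'e::banach_lattice set) (UNIV :: c0 set)"
  shows "\<exists>P :: 'e \<Rightarrow> c0. lattice_isomorphism P"
proof -
  obtain T :: "'e \<Rightarrow> c0" where T: "bij T" "\<And>x y. T x \<le> T y \<longleftrightarrow> x \<le> y"
    using assms unfolding order_isomorphic_def order_isomorphism_def by blast
  \<comment> \<open>Translations of \<open>c0\<close> preserve the order, so \<open>T\<close> can be
    normalised to send 0 to 0 and thus cone to cone.\<close>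
  define U where "U x = T x - T 0" for x
  define V where "V y = inv T (y + T 0)" for y
  have UV: "U (V y) = y" and VU: "V (U x) = x" for x y
    using T(1) by (simp_all add: U_def V_def bij_is_surj surj_f_inv_f bij_is_inj)
  have U_le: "U x \<le> U y \<longleftrightarrow> x \<le> y" for x y by (simp add: U_def T(2))
  then have V_le: "V x \<le> V y \<longleftrightarrow> x \<le> y" for x y by (metis UV)
  have le_V: "x \<le> V y \<longleftrightarrow> U x \<le> y" and V_le': "V y \<le> x \<longleftrightarrow> y \<le> U x" for x y by (metis U_le UV)+
  have U0: "U 0 = 0" by (simp add: U_def)
  then have V0: "V 0 = 0" by (metis VU)
  have U_nonneg: "0 \<le> U x \<longleftrightarrow> 0 \<le> x" and V_nonneg: "0 \<le> V y \<longleftrightarrow> 0 \<le> y" for x y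
    by (metis U0 U_le, metis V0 V_le)

  \<comment> \<open>Disjoint atoms from the unit vectors\<close>
  define b where "b k = V (c0_unit k)" for k
  have unit: "0 \<le> c0_unit k" "c0_unit k \<noteq> 0" for k
    by (simp add: less_eq_c0.rep_eq c0_unit.rep_eq zero_c0.rep_eq)
      (metis c0_unit.rep_eq zero_c0.rep_eq zero_neq_one)
  have unit_mono: "r *\<^sub>R c0_unit k \<le> s *\<^sub>R c0_unit k \<longleftrightarrow> r \<le> s" for r s k
    using unit[of k] by (intro scaleR_le_scaleR_iff) (simp add: less_le)
  have b_pos: "0 < b k" for k
    using unit[of k] V_nonneg[of "c0_unit k"] V0 UV by (metis b_def less_le)
  have below_b: "\<exists>r. 0 \<le> r \<and> r \<le> 1 \<and> U u = r *\<^sub>R c0_unit k" if "0 \<le> u" "u \<le> b k" for u k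
    using that below_c0_unit[of "U u" k] by (metis U_nonneg b_def le_V)
  have atom: "atom (b k)" for k
    unfolding atom_def
  proof (intro conjI ballI)
    fix u v assume "u \<in> {0..b k}" "v \<in> {0..b k}"
    then obtain r s where "U u = r *\<^sub>R c0_unit k" "U v = s *\<^sub>R c0_unit k"
      using below_b by (meson atLeastAtMost_iff)
    then show "u \<le> v \<or> v \<le> u" by (metis U_le unit_mono linear)
  qed (rule b_pos)
  \<comment> \<open>The coefficient \<open>m\<close> depends on \<open>r\<close> monotonically but
    perhaps not linearly, and only the range up to 1 is controlled. This is why coefficients are
    truncated at 1 below.\<close>
  have V_unit: "\<exists>m. 0 \<le> m \<and> m \<le> 1 \<and> V (r *\<^sub>R c0_unit k) = m *\<^sub>R b k" if "0 \<le> r" "r \<le> 1" for r k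
  proof -
    have "0 \<le> V (r *\<^sub>R c0_unit k)" using that unit by (simp add: V_nonneg scaleR_nonneg_nonneg)
    moreover have "V (r *\<^sub>R c0_unit k) \<le> b k"
      using that unit_mono[of r k 1] by (simp add: b_def V_le)
    ultimately show ?thesis by (meson atom atom_multiple)
  qed
  \<comment> \<open>The image of the infimum is a multiple of two different unit vectors, hence
    0.\<close>
  have disjoint: "inf (b j) (b k) = 0" if "j \<noteq> k" for j k
  proof -
    let ?z = "inf (b j) (b k)"
    have z: "0 \<le> ?z" using b_pos by (simp add: less_imp_le)
    obtain r s where rs: "U ?z = r *\<^sub>R c0_unit j" "U ?z = s *\<^sub>R c0_unit k"
      using below_b z by (meson inf_le1 inf_le2)
    then have "r *\<^sub>R c0_unit j = s *\<^sub>R c0_unit k" by simp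
    from arg_cong[OF this, of "\<lambda>x. c0_nth x j"] have "r = 0"
      using that by (simp add: scaleR_c0.rep_eq c0_unit.rep_eq)
    with rs have "U ?z = 0" by simp
    then show ?thesis by (metis VU V0)
  qed

  \<comment> \<open>A level below which the inverse is norm bounded\<close>
  obtain eps C where eps: "0 < eps" "eps < 1"
    and C: "\<And>x. 0 \<le> x \<Longrightarrow> (\<And>k. c0_nth (U x) k \<le> eps) \<Longrightarrow> norm x \<le> C"
  proof -
    \<comment> \<open>Otherwise some positive \<open>X j\<close> of norm above \<open>j\<close> have
      images of norm at most \<open>(1/2) ^ Suc j\<close>. These images sum to some
      \<open>z\<close>, and \<open>V z\<close> dominates every \<open>X j\<close>, which bounds
      their norms. The exponent \<open>Suc j\<close> keeps the level strictly below 1 even for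
      \<open>j = 0\<close>.\<close>
    have "\<exists>j. \<forall>x. 0 \<le> x \<and> (\<forall>k. c0_nth (U x) k \<le> (1/2) ^ Suc j) \<longrightarrow> norm x \<le> real j"
    proof (rule ccontr)
      assume "\<not> ?thesis"
      then obtain X where X: "\<And>j. 0 \<le> X j" "\<And>j k. c0_nth (U (X j)) k \<le> (1/2) ^ Suc j"
        "\<And>j. real j < norm (X j)"
        by (metis not_le)
      have pos: "0 \<le> c0_nth (U (X j)) k" for j k
        using X(1)[of j] U_nonneg[of "X j"] by (simp add: less_eq_c0.rep_eq zero_c0.rep_eq)
      have "norm (U (X j)) \<le> (1/2) ^ Suc j" for j
        using X(2) pos by (intro norm_c0_le) simp
      then have sm: "summable (\<lambda>j. U (X j))"
        by (rule summable_comparison_test'[where N = 0, rotated])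
          (simp add: summable_mult summable_geometric)
      define z where "z = (\<Sum>j. U (X j))"
      have "U (X j) \<le> z" for j
      proof -
        have "c0_nth (U (X j)) k \<le> c0_nth z k" for k
        proof -
          have s: "(\<lambda>j. c0_nth (U (X j)) k) sums c0_nth z k"
            unfolding z_def using sm by (intro bounded_linear.sums[OF bounded_linear_c0_nth] summable_sums)
          then have "(\<Sum>i\<in>{j}. c0_nth (U (X i)) k) \<le> (\<Sum>i. c0_nth (U (X i)) k)"
            using pos by (intro sum_le_suminf) (auto simp: sums_iff)
          with s show ?thesis by (simp add: sums_iff)
        qed
        then show ?thesis by (simp add: less_eq_c0.rep_eq)
      qed
      then have "norm (X j) \<le> norm (V z)" for j
        using X(1) by (intro norm_mono_nonneg) (simp_all add: le_V)
      then have "real j \<le> norm (V z)" for j using X(3)[of j] by (meson less_imp_le order_trans)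
      moreover obtain j :: nat where "norm (V z) < real j" using reals_Archimedean2 by blast
      ultimately show False by (meson not_le)
    qed
    then obtain j where j: "\<And>x. 0 \<le> x \<Longrightarrow> (\<And>k. c0_nth (U x) k \<le> (1/2) ^ Suc j) \<Longrightarrow> norm x \<le> real j"
      by blast
    show ?thesis
    proof (rule that[of "(1/2) ^ Suc j" "real j"])
      show "(1/2::real) ^ Suc j < 1" by (rule power_Suc_less_one) simp_all
    qed (use j in simp_all)
  qed

  \<comment> \<open>Weights and coordinate functionals\<close>
  obtain w where w: "\<And>k. 0 \<le> w k" "\<And>k. w k \<le> 1" "\<And>k. V (eps *\<^sub>R c0_unit k) = w k *\<^sub>R b k"
    using V_unit[of eps] eps by (metis less_imp_le)
  have w_pos: "0 < w k" for k
  proof -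
    have "V (eps *\<^sub>R c0_unit k) \<noteq> 0" using eps unit[of k] by (metis UV U0 scaleR_eq_0_iff less_irrefl)
    then show ?thesis using w(1,3)[of k] by (cases "w k = 0") (simp_all add: less_le)
  qed
  \<comment> \<open>Strictness lets the truncation at 1 be removed in
    \<open>le_level\<close>.\<close>
  have w_less: "w k < 1" for k
  proof -
    have "w k \<noteq> 1"
    proof
      assume "w k = 1"
      then have "V (eps *\<^sub>R c0_unit k) = V (1 *\<^sub>R c0_unit k)" using w(3)[of k] by (simp add: b_def)
      then have "eps *\<^sub>R c0_unit k = 1 *\<^sub>R c0_unit k" by (metis UV)
      then show False using eps unit[of k] by (simp only: scaleR_cancel_right) simp
    qed
    then show ?thesis using w(2)[of k] by simp
  qed
  define f where "f k = coord (b k)" for k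
  have f_lin: "bounded_linear (f k)" for k unfolding f_def using atom by (rule bounded_linear_coord)
  have f_abs: "f k \<bar>x\<bar> = \<bar>f k x\<bar>" for k x unfolding f_def using atom by (rule coord_abs)
  have f_b: "f j (b k) = (if j = k then 1 else 0)" for j k
    unfolding f_def using atom disjoint b_pos by (simp add: coord_self coord_disjoint less_imp_le)
  have f_ge: "m \<le> f k x" if "0 \<le> m" "m *\<^sub>R b k \<le> x" for m k x
  proof -
    have "0 \<le> x" using that b_pos[of k] by (meson less_imp_le order_trans scaleR_nonneg_nonneg)
    then show ?thesis using that atom b_pos by (simp add: f_def coord_nonneg_eq cone_coord_ge)
  qed
  have f_le: "f k x *\<^sub>R b k \<le> x" "0 \<le> f k x" if "0 \<le> x" for k x
    using that atom b_pos
    by (simp_all add: f_def coord_nonneg_eq cone_coord_scaleR_le cone_coord_nonneg)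
  have min_unit: "min 1 (c0_nth (U x) k) *\<^sub>R c0_unit k \<le> U x" if "0 \<le> x" for x k
    using that by (simp add: scaleR_c0_unit_le_iff U_nonneg)
  have nth_nonneg: "0 \<le> c0_nth (U x) k" if "0 \<le> x" for x k
    using that U_nonneg[of x] by (simp add: less_eq_c0.rep_eq zero_c0.rep_eq)

  \<comment> \<open>Together with its converse \<open>le_level\<close> this transfers coordinate
    information at the single level \<open>eps\<close>; linearity of the functionals does the rest.
    The truncated coordinate yields a multiple of \<open>b k\<close> below \<open>x\<close>, and
    \<open>eps < 1\<close> makes the truncation harmless.\<close>
  have level_le: "c0_nth (U x) k \<le> eps" if x: "0 \<le> x" and le: "f k x \<le> w k" for x k
  proof -
    let ?r = "min 1 (c0_nth (U x) k)"
    obtain m where m: "0 \<le> m" "V (?r *\<^sub>R c0_unit k) = m *\<^sub>R b k"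
      using V_unit[of ?r k] nth_nonneg[OF x] by auto
    have "m *\<^sub>R b k \<le> x" using min_unit[OF x] by (simp add: m(2)[symmetric] V_le')
    then have "m \<le> w k" using f_ge[OF m(1)] le by (meson order_trans)
    then have "V (?r *\<^sub>R c0_unit k) \<le> V (eps *\<^sub>R c0_unit k)"
      using b_pos[of k] by (simp add: m(2) w(3) scaleR_le_scaleR_iff)
    then have "?r \<le> eps" by (simp add: V_le unit_mono)
    then show ?thesis using eps by (simp add: min_def split: if_splits)
  qed
  have le_level: "f k x \<le> w k" if x: "0 \<le> x" and le: "c0_nth (U x) k \<le> eps" for x k
  proof -
    let ?l = "min 1 (f k x)"
    have l0: "0 \<le> ?l" using f_le(2)[OF x] by simp
    have l: "?l *\<^sub>R b k \<le> 1 *\<^sub>R b k" "?l *\<^sub>R b k \<le> f k x *\<^sub>R b k"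
      using b_pos[of k] by (simp_all only: scaleR_le_scaleR_iff min.cobounded1 min.cobounded2)
    have lx: "?l *\<^sub>R b k \<le> x" using l(2) f_le(1)[OF x] by (rule order_trans)
    have l_nn: "0 \<le> ?l *\<^sub>R b k" using l0 b_pos[of k] by (intro scaleR_nonneg_nonneg) simp_all
    obtain r where r: "U (?l *\<^sub>R b k) = r *\<^sub>R c0_unit k"
      using below_b[of "?l *\<^sub>R b k" k] l(1) l_nn by auto
    have "r *\<^sub>R c0_unit k \<le> U x" using lx by (simp add: r[symmetric] U_le)
    then have "r \<le> eps" using le x by (simp add: scaleR_c0_unit_le_iff U_nonneg)
    then have "U (?l *\<^sub>R b k) \<le> eps *\<^sub>R c0_unit k" by (simp add: r unit_mono)
    then have "?l *\<^sub>R b k \<le> w k *\<^sub>R b k" by (simp add: le_V[symmetric] w(3))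
    then have "?l \<le> w k" using b_pos[of k] by (simp only: scaleR_le_scaleR_iff)
    then show ?thesis using w_less[of k] by (simp add: min_def split: if_splits)
  qed
  \<comment> \<open>A positive coordinate of \<open>U \<bar>x\<bar>\<close> would give a nonzero
    multiple of \<open>b k\<close> below \<open>\<bar>x\<bar>\<close>, which \<open>f k\<close>
    detects.\<close>
  have separating: "x = 0" if "\<And>k. f k x = 0" for x
  proof -
    have f0: "f k \<bar>x\<bar> = 0" for k using that by (simp add: f_abs)
    have "c0_nth (U \<bar>x\<bar>) k = 0" for k
    proof -
      let ?r = "min 1 (c0_nth (U \<bar>x\<bar>) k)"
      obtain m where m: "0 \<le> m" "V (?r *\<^sub>R c0_unit k) = m *\<^sub>R b k"
        using V_unit[of ?r k] nth_nonneg[of "\<bar>x\<bar>"] by auto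
      have "m *\<^sub>R b k \<le> \<bar>x\<bar>" using min_unit[of "\<bar>x\<bar>"] by (simp add: m(2)[symmetric] V_le')
      then have "m = 0" using f_ge[OF m(1)] f0[of k] m(1) by (metis antisym)
      then have "?r *\<^sub>R c0_unit k = 0" using m(2) by (metis UV U0 scaleR_zero_left)
      then have "?r = 0" using unit[of k] by simp
      then show ?thesis by (simp add: min_def split: if_splits)
    qed
    then have "U \<bar>x\<bar> = 0" by (intro c0_eqI) (simp add: zero_c0.rep_eq)
    then have "\<bar>x\<bar> = 0" by (metis VU V0)
    then show ?thesis by simp
  qed
  have null: "(\<lambda>k. f k x / w k) \<longlonglongrightarrow> 0" for x
  proof (rule LIMSEQ_I)
    fix e :: real assume e: "0 < e"
    \<comment> \<open>The scaling by \<open>N\<close> happens before the nonlinear \<open>U\<close>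
      is applied, so \<open>f k\<close> can undo it; the factor 2 makes the final bound
      strict.\<close>
    define N where "N = 2 / e"
    have N: "0 < N" using e by (simp add: N_def)
    have Nx: "0 \<le> N *\<^sub>R \<bar>x\<bar>" using N by (simp add: scaleR_nonneg_nonneg)
    obtain k0 where k0: "\<And>k. k \<ge> k0 \<Longrightarrow> \<bar>c0_nth (U (N *\<^sub>R \<bar>x\<bar>)) k\<bar> < eps"
      using LIMSEQ_D[OF c0_nth_tendsto eps(1)] by auto
    show "\<exists>k0. \<forall>k\<ge>k0. norm (f k x / w k - 0) < e"
    proof (intro exI[of _ k0] allI impI)
      fix k assume "k0 \<le> k"
      then have "f k (N *\<^sub>R \<bar>x\<bar>) \<le> w k" using k0[of k] by (intro le_level[OF Nx]) simp
      then have "N * \<bar>f k x\<bar> \<le> w k"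
        by (simp add: linear_cmul[OF bounded_linear.linear[OF f_lin]] f_abs)
      then have "\<bar>f k x\<bar> / w k \<le> e / 2" using w_pos[of k] e by (simp add: N_def field_simps)
      also have "e / 2 < e" using e by simp
      finally show "norm (f k x / w k - 0) < e" using w_pos[of k] by simp
    qed
  qed
  \<comment> \<open>Since \<open>f k\<close> sees at most the term \<open>w k *\<^sub>R b k\<close>,
    the image of every finite sum stays at level \<open>eps\<close>, where \<open>C\<close> bounds
    the norm.\<close>
  have sum_bound: "norm (\<Sum>k\<in>F. w k *\<^sub>R b k) \<le> C" if "finite F" for F
  proof -
    let ?z = "\<Sum>k\<in>F. w k *\<^sub>R b k"
    have z: "0 \<le> ?z" using w_pos b_pos by (intro sum_nonneg scaleR_nonneg_nonneg) (simp_all add: less_imp_le)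
    have "f k ?z \<le> w k" for k
    proof -
      have "f k ?z = (\<Sum>j\<in>F. w j * f k (b j))"
        using bounded_linear.linear[OF f_lin] by (simp add: linear_sum linear_cmul)
      also have "\<dots> = (\<Sum>j\<in>F. if k = j then w k else 0)"
        by (intro sum.cong) (auto simp: f_b)
      also have "\<dots> \<le> w k" using that w_pos[of k] by (simp add: less_imp_le)
      finally show ?thesis .
    qed
    then show ?thesis using z by (intro C level_le)
  qed

  \<comment> \<open>The lattice isomorphism\<close>
  define P where "P x = Abs_c0 (\<lambda>k. f k x / w k)" for x
  have P_nth: "c0_nth (P x) k = f k x / w k" for x k
    unfolding P_def using null by (simp add: Abs_c0_inverse)
  have lin: "linear P"
    by (rule linearI; rule c0_eqI)
      (simp_all add: P_nth c0_nth_simps add_divide_distrib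
        linear_add[OF bounded_linear.linear[OF f_lin]] linear_cmul[OF bounded_linear.linear[OF f_lin]])
  have "inj P"
  proof (rule linear_injective_0[OF lin, THEN iffD2], intro allI impI)
    fix x assume "P x = 0"
    then have "f k x / w k = 0" for k by (simp flip: P_nth add: zero_c0.rep_eq)
    then have "f k x = 0" for k using w_pos[of k] by (metis divide_eq_0_iff less_irrefl)
    then show "x = 0" by (rule separating)
  qed
  moreover have "surj P"
  proof (rule surjI)
    fix y :: c0
    let ?h = "\<lambda>k. c0_nth y k *\<^sub>R (w k *\<^sub>R b k)"
    have sm: "summable ?h"
      using c0_nth_tendsto[of y] w_pos b_pos sum_bound
      by (intro summable_null_scaleR[where C = C] scaleR_nonneg_nonneg) (simp_all add: less_imp_le)
    show "P (suminf ?h) = y"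
    proof (rule c0_eqI)
      fix j
      have "(\<lambda>k. f j (?h k)) sums f j (suminf ?h)"
        using sm by (intro bounded_linear.sums[OF f_lin] summable_sums)
      moreover have "f j (?h k) = (if k = j then c0_nth y j * w j else 0)" for k
        by (simp add: linear_cmul[OF bounded_linear.linear[OF f_lin]] f_b)
      ultimately have "(\<lambda>k. if k = j then c0_nth y j * w j else 0) sums f j (suminf ?h)" by simp
      then have "f j (suminf ?h) = c0_nth y j * w j"
        using sums_single[of j "\<lambda>_. c0_nth y j * w j"] sums_unique2 by blast
      then show "c0_nth (P (suminf ?h)) j = c0_nth y j" using w_pos[of j] by (simp add: P_nth)
    qed
  qed
  moreover have "P \<bar>x\<bar> = \<bar>P x\<bar>" for x
    by (rule c0_eqI) (use w_pos in \<open>simp add: P_nth abs_c0.rep_eq f_abs abs_mult less_imp_le\<close>)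
  ultimately show ?thesis using lin unfolding lattice_isomorphism_def bij_def by blast
qed

text \<open>The relation \<open>x \<le> y\<close> says that \<open>y - x\<close> equals its own
  modulus, which a linear bijection preserving moduli respects in both directions.\<close>

lemma lattice_isomorphism_imp_order_isomorphism:
  assumes "lattice_isomorphism T"
  shows "order_isomorphism UNIV UNIV T"
proof -
  have lin: "linear T" and bij: "bij T" and abs: "\<And>x. T \<bar>x\<bar> = \<bar>T x\<bar>"
    using assms by (auto simp: lattice_isomorphism_def)
  have "x \<le> y \<longleftrightarrow> T x \<le> T y" for x y
  proof -
    have "x \<le> y \<longleftrightarrow> \<bar>y - x\<bar> = y - x" by (metis abs_of_nonneg abs_ge_zero diff_ge_0_iff_ge)
    also have "\<dots> \<longleftrightarrow> T \<bar>y - x\<bar> = T (y - x)" using bij by (simp add: bij_is_inj inj_eq)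
    also have "\<dots> \<longleftrightarrow> \<bar>T y - T x\<bar> = T y - T x" by (simp add: abs linear_diff[OF lin])
    also have "\<dots> \<longleftrightarrow> T x \<le> T y" by (metis abs_of_nonneg abs_ge_zero diff_ge_0_iff_ge)
    finally show ?thesis .
  qed
  with bij show ?thesis by (simp add: order_isomorphism_def)
qed

section \<open>Closed sublattices of the sequence space\<close>

text \<open>An instance of the order continuity of the norm of \<open>c0\<close>: finite infima
  approximate the pointwise infimum on finitely many coordinates, and domination by \<open>x\<close>
  makes the remaining ones small.\<close>

lemma c0_Inf_in_closure:
  assumes "x \<in> K" and nonneg: "\<And>u. u \<in> K \<Longrightarrow> 0 \<le> u"
    and inf: "\<And>u v. u \<in> K \<Longrightarrow> v \<in> K \<Longrightarrow> inf u v \<in> K"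
  obtains v where "v \<in> closure K" "\<And>m. c0_nth v m = (INF u\<in>K. c0_nth u m)"
proof -
  have nn: "0 \<le> c0_nth u m" if "u \<in> K" for u m
    using nonneg[OF that] by (simp add: less_eq_c0.rep_eq zero_c0.rep_eq)
  have bdd: "bdd_below ((\<lambda>u. c0_nth u m) ` K)" for m
    using nn by (auto intro: bdd_belowI[of _ 0])
  let ?v = "\<lambda>m. INF u\<in>K. c0_nth u m"
  have v0: "0 \<le> ?v m" for m using nn \<open>x \<in> K\<close> by (intro cINF_greatest) auto
  have v_le: "?v m \<le> c0_nth u m" if "u \<in> K" for u m using bdd that by (rule cINF_lower)
  have "?v \<longlonglongrightarrow> 0"
    by (rule Lim_null_comparison[OF _ c0_nth_tendsto[of x]]) (use v0 v_le[OF \<open>x \<in> K\<close>] in simp)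
  then have v: "c0_nth (Abs_c0 ?v) m = ?v m" for m by (simp add: Abs_c0_inverse)
  have "Abs_c0 ?v \<in> closure K"
    unfolding closure_approachable
  proof (intro allI impI)
    fix e :: real assume e: "0 < e"
    have approx: "\<exists>u\<in>K. u \<le> x \<and> (\<forall>m<M. c0_nth u m \<le> ?v m + e / 2)" for M
    proof (induction M)
      case 0
      then show ?case using \<open>x \<in> K\<close> by auto
    next
      case (Suc M)
      then obtain u where u: "u \<in> K" "u \<le> x" "\<And>m. m < M \<Longrightarrow> c0_nth u m \<le> ?v m + e / 2" by blast
      have "?v M < ?v M + e / 2" using e by simp
      then obtain u' where u': "u' \<in> K" "c0_nth u' M < ?v M + e / 2"
        using cINF_less_iff[OF _ bdd] \<open>x \<in> K\<close> by blast
      have "inf u u' \<le> x" using u(2) by (rule le_infI1)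
      moreover have "c0_nth (inf u u') m \<le> ?v m + e / 2" if "m < Suc M" for m
        using that u(3)[of m] u'(2) by (auto simp: inf_c0.rep_eq less_Suc_eq min_le_iff_disj)
      ultimately show ?case using inf[OF u(1) u'(1)] by blast
    qed
    obtain M where M: "\<And>m. m \<ge> M \<Longrightarrow> \<bar>c0_nth x m\<bar> < e / 2"
      using LIMSEQ_D[OF c0_nth_tendsto[of x], of "e / 2"] e by auto
    obtain u where u: "u \<in> K" "u \<le> x" "\<And>m. m < M \<Longrightarrow> c0_nth u m \<le> ?v m + e / 2"
      using approx[of M] by blast
    have "\<bar>c0_nth (u - Abs_c0 ?v) m\<bar> \<le> e / 2" for m
    proof -
      have "c0_nth u m \<le> ?v m + e / 2"
      proof (cases "m < M")
        case False
        have "c0_nth u m \<le> c0_nth x m" using u(2) by (simp add: less_eq_c0.rep_eq)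
        then show ?thesis using False M[of m] v0[of m] by simp
      qed (rule u(3))
      then show ?thesis using v_le[OF u(1), of m] by (simp add: minus_c0.rep_eq v abs_le_iff)
    qed
    then have "norm (u - Abs_c0 ?v) \<le> e / 2" by (rule norm_c0_le)
    then have "dist u (Abs_c0 ?v) < e" using e by (simp add: dist_norm)
    with u(1) show "\<exists>y\<in>K. dist y (Abs_c0 ?v) < e" by blast
  qed
  with v show ?thesis using that by blast
qed

locale closed_sublattice =
  fixes S :: "c0 set"
  assumes cl: "closed S" and sub: "sublattice S"
begin

lemma subspace: "subspace S" and sup_in: "x \<in> S \<Longrightarrow> y \<in> S \<Longrightarrow> sup x y \<in> S"
  and inf_in: "x \<in> S \<Longrightarrow> y \<in> S \<Longrightarrow> inf x y \<in> S"
  using sub by (auto simp: sublattice_def)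

text \<open>The notion \<open>atom\<close> concerns a whole type; here only elements of
  \<open>S\<close> are tested, so such an element may have many nonzero coordinates. Norm one
  selects one representative from each ray.\<close>

definition unit_atoms :: "c0 set" where
  "unit_atoms = {e \<in> S. 0 \<le> e \<and> norm e = 1 \<and> (\<forall>u\<in>S. 0 \<le> u \<and> u \<le> e \<longrightarrow> (\<exists>m. u = m *\<^sub>R e))}"

text \<open>
  The least element \<open>v\<close> of \<open>S\<close> with \<open>v\<^sub>n = 1\<close> below a given one is an atom: for \<open>0 \<le> u \<le> v\<close> minimality
  yields both \<open>u\<^sub>n v \<le> u\<close> and, applied to \<open>v - u\<close>, the reverse inequality.
\<close>

lemma unit_atom_exists:
  assumes "x \<in> S" "c0_nth x n \<noteq> 0"
  shows "\<exists>e\<in>unit_atoms. 0 < c0_nth e n"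
proof -
  define x' where "x' = inverse \<bar>c0_nth x n\<bar> *\<^sub>R \<bar>x\<bar>"
  have "\<bar>x\<bar> \<in> S" using assms sup_in[of x "- x"] by (simp add: abs_lattice subspace subspace_neg)
  then have x': "x' \<in> S" "0 \<le> x'" "c0_nth x' n = 1"
    using assms by (simp_all add: x'_def subspace subspace_scale scaleR_nonneg_nonneg c0_nth_simps)
  define K where "K = {u \<in> S. 0 \<le> u \<and> u \<le> x' \<and> c0_nth u n = 1}"
  have "x' \<in> K" using x' by (simp add: K_def)
  obtain v where v: "v \<in> closure K" "\<And>m. c0_nth v m = (INF u\<in>K. c0_nth u m)"
  proof (rule c0_Inf_in_closure[OF \<open>x' \<in> K\<close>])
    show "0 \<le> u" if "u \<in> K" for u using that by (simp add: K_def)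
    show "inf u v \<in> K" if "u \<in> K" "v \<in> K" for u v
      using that by (auto simp: K_def inf_in inf_c0.rep_eq intro: le_infI1)
  qed (rule that)
  have "K \<subseteq> S" by (auto simp: K_def)
  then have vS: "v \<in> S" using v(1) cl closure_minimal by blast
  have nn: "0 \<le> c0_nth u m" if "u \<in> K" for u m
    using that by (simp add: K_def less_eq_c0.rep_eq zero_c0.rep_eq)
  have v0: "0 \<le> v"
    using nn \<open>x' \<in> K\<close> by (auto simp: less_eq_c0.rep_eq zero_c0.rep_eq v(2) intro!: cINF_greatest)
  have vK: "v \<le> u" if "u \<in> K" for u
    unfolding less_eq_c0.rep_eq v(2)
    using that nn by (auto intro!: cINF_lower bdd_belowI[of _ 0])
  have "(\<lambda>u. c0_nth u n) ` K = {1}" using \<open>x' \<in> K\<close> by (force simp: K_def)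
  then have vn: "c0_nth v n = 1" by (simp add: v(2))
  have lower: "c0_nth u n *\<^sub>R v \<le> u" if u: "u \<in> S" "0 \<le> u" for u
  proof (cases "c0_nth u n = 0")
    case True
    then show ?thesis using u by simp
  next
    case False
    then have m: "0 < c0_nth u n"
      using u by (simp add: less_eq_c0.rep_eq zero_c0.rep_eq less_le)
    \<comment> \<open>Both elements have \<open>n\<close>-th coordinate 1, and the infimum with
      \<open>x'\<close> restores the upper bound required in \<open>K\<close>.\<close>
    have "inf (inverse (c0_nth u n) *\<^sub>R u) x' \<in> K"
      using u x' m
      by (simp add: K_def inf_in subspace subspace_scale scaleR_nonneg_nonneg c0_nth_simps)
    then have "v \<le> inverse (c0_nth u n) *\<^sub>R u" using vK by fastforce
    then have "c0_nth u n *\<^sub>R v \<le> c0_nth u n *\<^sub>R (inverse (c0_nth u n) *\<^sub>R u)"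
      using m by (intro scaleR_left_mono) simp_all
    then show ?thesis using m by simp
  qed
  have mult: "u = c0_nth u n *\<^sub>R v" if u: "u \<in> S" "0 \<le> u" "u \<le> v" for u
  proof (rule antisym)
    have "c0_nth (v - u) n *\<^sub>R v \<le> v - u"
      using u vS by (intro lower) (simp_all add: subspace subspace_diff)
    then show "u \<le> c0_nth u n *\<^sub>R v" by (simp add: c0_nth_simps vn algebra_simps)
  qed (rule lower[OF u(1,2)])
  define e where "e = inverse (norm v) *\<^sub>R v"
  have "v \<noteq> 0" using vn by (auto simp: zero_c0.rep_eq)
  then have nv: "0 < norm v" by simp
  have ve: "v = norm v *\<^sub>R e" using nv by (simp add: e_def)
  have "e \<in> unit_atoms"
    unfolding unit_atoms_def
  proof (intro CollectI conjI ballI impI)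
    show "e \<in> S" "0 \<le> e" "norm e = 1"
      using vS v0 nv by (simp_all add: e_def subspace subspace_scale scaleR_nonneg_nonneg)
    fix u assume u: "u \<in> S" "0 \<le> u \<and> u \<le> e"
    then have "norm v *\<^sub>R u \<le> norm v *\<^sub>R e" by (intro scaleR_left_mono) simp_all
    then have "norm v *\<^sub>R u \<le> v" using ve by simp
    then have "norm v *\<^sub>R u = c0_nth (norm v *\<^sub>R u) n *\<^sub>R v"
      using u by (intro mult) (simp_all add: subspace subspace_scale scaleR_nonneg_nonneg)
    then have "norm v *\<^sub>R u = norm v *\<^sub>R (c0_nth (norm v *\<^sub>R u) n *\<^sub>R e)"
      by (metis ve scaleR_left_commute)
    then show "\<exists>m. u = m *\<^sub>R e" using nv by (metis less_irrefl scaleR_left_imp_eq)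
  qed
  moreover have "0 < c0_nth e n" using nv by (simp add: e_def scaleR_c0.rep_eq vn)
  ultimately show ?thesis by blast
qed

text \<open>The infimum is a multiple of both atoms and is positive at \<open>n\<close>; equal norms
  then make the two factors agree. Distinct unit atoms thus have disjoint supports.\<close>

lemma unit_atom_unique:
  assumes e: "e \<in> unit_atoms" "0 < c0_nth e n" and e': "e' \<in> unit_atoms" "0 < c0_nth e' n"
  shows "e = e'"
proof -
  let ?u = "inf e e'"
  have u: "?u \<in> S" "0 \<le> ?u" using e e' by (auto simp: unit_atoms_def inf_in)
  have "\<exists>m. ?u = m *\<^sub>R a" if "a \<in> unit_atoms" "?u \<le> a" for a
    using that u unfolding unit_atoms_def by blast
  then obtain m m' where m: "?u = m *\<^sub>R e" "?u = m' *\<^sub>R e'"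
    using e(1) e'(1) by (meson inf_le1 inf_le2)
  have "0 < c0_nth ?u n" using e e' by (simp add: inf_c0.rep_eq)
  then have "0 < c0_nth (m *\<^sub>R e) n" "0 < c0_nth (m' *\<^sub>R e') n"
    using m by metis+
  then have pos: "0 < m" "0 < m'" using e e' by (simp_all add: scaleR_c0.rep_eq zero_less_mult_iff)
  have "norm (m *\<^sub>R e) = norm (m' *\<^sub>R e')" using m by metis
  then have "m = m'" using e e' pos by (simp add: unit_atoms_def)
  then show ?thesis using m pos(1) by (metis less_irrefl scaleR_left_imp_eq)
qed

lemma unit_atom_le_one: "e \<in> unit_atoms \<Longrightarrow> 0 \<le> c0_nth e n \<and> c0_nth e n \<le> 1"
  using c0_nth_le_norm[of e n] by (auto simp: unit_atoms_def less_eq_c0.rep_eq zero_c0.rep_eq)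

text \<open>On the support of \<open>e\<close> every element of \<open>S\<close> is a multiple of
  \<open>e\<close>, with its value at the peak \<open>p\<close> as factor. For positive
  \<open>z\<close> the truncation by a large multiple of \<open>e\<close> is itself a multiple of
  \<open>e\<close>.\<close>

lemma nth_eq_peak:
  assumes e: "e \<in> unit_atoms" "c0_nth e p = 1" "0 < c0_nth e n" and x: "x \<in> S"
  shows "c0_nth x n = c0_nth x p * c0_nth e n"
proof -
  have pos: "c0_nth z n = c0_nth z p * c0_nth e n" if z: "z \<in> S" "0 \<le> z" for z
  proof -
    \<comment> \<open>Large enough that truncation by \<open>l *\<^sub>R e\<close> changes
      \<open>z\<close> neither at \<open>n\<close> nor at \<open>p\<close>, because
      \<open>c0_nth e n\<close> is at most 1; the summand 1 keeps \<open>l\<close> positive when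
      \<open>z = 0\<close>.\<close>
    define l where "l = 1 + norm z / c0_nth e n"
    have l: "0 < l" using e by (simp add: l_def add_pos_nonneg)
    let ?u = "inf z (l *\<^sub>R e)"
    have eS: "e \<in> S" "0 \<le> e" using e by (auto simp: unit_atoms_def)
    have "inverse l *\<^sub>R ?u \<le> inverse l *\<^sub>R (l *\<^sub>R e)" using l by (intro scaleR_left_mono) simp_all
    then have "inverse l *\<^sub>R ?u \<le> e" using l by simp
    moreover have "inverse l *\<^sub>R ?u \<in> S" "0 \<le> inverse l *\<^sub>R ?u"
      using z eS l by (simp_all add: inf_in subspace subspace_scale scaleR_nonneg_nonneg)
    ultimately obtain m where "inverse l *\<^sub>R ?u = m *\<^sub>R e"
      using e(1) unfolding unit_atoms_def by blast
    then have "l *\<^sub>R (inverse l *\<^sub>R ?u) = l *\<^sub>R (m *\<^sub>R e)" by simp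
    then have u: "?u = (l * m) *\<^sub>R e" using l by simp
    have "norm z \<le> norm z / c0_nth e n"
      using e(3) unit_atom_le_one[OF e(1), of n] by (simp add: pos_le_divide_eq mult_left_le)
    then have "c0_nth z p \<le> l" using c0_nth_le_norm[of z p] by (simp add: l_def)
    then have "c0_nth ?u p = c0_nth z p" using e by (simp add: c0_nth_simps)
    then have zp: "c0_nth z p = l * m" using e by (simp add: u scaleR_c0.rep_eq)
    have "c0_nth z n \<le> l * c0_nth e n"
      using e(3) c0_nth_le_norm[of z n] by (simp add: l_def algebra_simps)
    then have "c0_nth ?u n = c0_nth z n" by (simp add: c0_nth_simps)
    then show ?thesis by (simp add: u scaleR_c0.rep_eq zp)
  qed
  have "sup x 0 \<in> S" "sup (- x) 0 \<in> S" using x by (simp_all add: sup_in subspace subspace_neg subspace_0)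
  then have "c0_nth (sup x 0) n - c0_nth (sup (- x) 0) n
      = (c0_nth (sup x 0) p - c0_nth (sup (- x) 0) p) * c0_nth e n"
    using pos[of "sup x 0"] pos[of "sup (- x) 0"] by (simp add: left_diff_distrib)
  moreover have "c0_nth (sup x 0) m - c0_nth (sup (- x) 0) m = c0_nth x m" for m
    by (simp add: c0_nth_simps max_def)
  ultimately show ?thesis by simp
qed

text \<open>The isomorphism samples an element at one peak of each unit atom; these values determine
  it on all of \<open>S\<close>.\<close>

lemma order_isomorphic_c0:
  assumes inf_dim: "infinite_dimensional S"
  shows "order_isomorphic S (UNIV :: c0 set)"
proof -
  have "\<exists>n. c0_nth e n = 1" if "e \<in> unit_atoms" for e
    using c0_norm_attained[of e] unit_atom_le_one[OF that] that by (auto simp: unit_atoms_def)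
  then obtain pk where pk: "\<And>e. e \<in> unit_atoms \<Longrightarrow> c0_nth e (pk e) = 1" by metis
  have inj: "inj_on pk unit_atoms"
    by (rule inj_onI) (metis pk unit_atom_unique zero_less_one)

  \<comment> \<open>Infinitely many atoms\<close>
  have "infinite unit_atoms"
  proof
    assume fin: "finite unit_atoms"
    have "x \<in> span unit_atoms" if x: "x \<in> S" for x
    proof -
      \<comment> \<open>At each index at most one atom is positive, and where none is, all of
        \<open>S\<close> vanishes. Finitely many atoms would therefore span
        \<open>S\<close>.\<close>
      have "x = (\<Sum>e\<in>unit_atoms. c0_nth x (pk e) *\<^sub>R e)"
      proof (rule c0_eqI)
        fix n
        show "c0_nth x n = c0_nth (\<Sum>e\<in>unit_atoms. c0_nth x (pk e) *\<^sub>R e) n"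
        proof (cases "\<exists>e\<in>unit_atoms. 0 < c0_nth e n")
          case True
          then obtain e where e: "e \<in> unit_atoms" "0 < c0_nth e n" by blast
          have "c0_nth (\<Sum>e\<in>unit_atoms. c0_nth x (pk e) *\<^sub>R e) n
              = (\<Sum>e'\<in>unit_atoms. if e' = e then c0_nth x (pk e) * c0_nth e n else 0)"
            unfolding c0_nth_sum scaleR_c0.rep_eq
            using unit_atom_unique[OF e] unit_atom_le_one[of _ n]
            by (intro sum.cong) (auto simp: less_le)
          also have "\<dots> = c0_nth x n" using fin e nth_eq_peak[OF e(1) pk e(2) x] by simp
          finally show ?thesis by simp
        next
          case False
          then have "c0_nth e n = 0" if "e \<in> unit_atoms" for e
            using that unit_atom_le_one[OF that, of n] by (force simp: less_le)
          moreover have "c0_nth x n = 0" using False x unit_atom_exists by blast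
          ultimately show ?thesis by (simp add: c0_nth_sum scaleR_c0.rep_eq)
        qed
      qed
      then show ?thesis by (metis (no_types, lifting) span_sum span_scale span_base)
    qed
    with fin inf_dim show False unfolding infinite_dimensional_def by blast
  qed
  then have inf: "infinite (pk ` unit_atoms)" using inj by (simp add: finite_image_iff)

  \<comment> \<open>Enumeration of the peaks\<close>
  define a where "a = enumerate (pk ` unit_atoms)"
  \<comment> \<open>Enumerating in increasing order makes the samples a subsequence of
    \<open>x\<close>, hence a null sequence.\<close>
  have mono: "strict_mono a" unfolding a_def using inf by (rule strict_mono_enumerate)
  have range_a: "range a = pk ` unit_atoms" unfolding a_def using inf by (rule range_enumerate)
  define e where "e k = inv_into unit_atoms pk (a k)" for k
  have ak: "a k \<in> pk ` unit_atoms" for k using range_a by blast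
  have e: "e k \<in> unit_atoms" "pk (e k) = a k" for k
    using ak by (simp_all add: e_def inv_into_into f_inv_into_f)
  have e_surj: "\<exists>k. e' = e k" if "e' \<in> unit_atoms" for e'
  proof -
    obtain k where "pk e' = a k" using imageI[OF \<open>e' \<in> unit_atoms\<close>, of pk] unfolding range_a[symmetric] by (rule rangeE)
    then have "pk e' = pk (e k)" by (simp only: e(2))
    then have "e' = e k" using that e(1) by (rule inj_onD[OF inj])
    then show ?thesis by (rule exI)
  qed
  have peak: "c0_nth (e k) (a k) = 1" for k using pk[OF e(1)[of k]] by (simp add: e(2))
  have e_eqD: "j = k" if "0 < c0_nth (e j) n" "0 < c0_nth (e k) n" for j k n
  proof -
    have "e j = e k" using that e(1) unit_atom_unique by blast
    then have "a j = a k" using e(2) by metis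
    then show ?thesis using mono by (simp add: strict_mono_eq)
  qed
  have e_a: "c0_nth (e j) (a k) = (if j = k then 1 else 0)" for j k
    using peak[of k] e_eqD[of j "a k" k] unit_atom_le_one[OF e(1), of j "a k"] by (auto simp: less_le)

  \<comment> \<open>Sampling at the peaks\<close>
  define R where "R x = Abs_c0 (c0_nth x \<circ> a)" for x
  have R_nth: "c0_nth (R x) k = c0_nth x (a k)" for x k
    unfolding R_def using LIMSEQ_subseq_LIMSEQ[OF c0_nth_tendsto[of x] mono] by (simp add: Abs_c0_inverse)
  have R_le: "R x \<le> R y \<longleftrightarrow> x \<le> y" if "x \<in> S" "y \<in> S" for x y
  proof
    assume le: "R x \<le> R y"
    show "x \<le> y"
      unfolding less_eq_c0.rep_eq
    proof
      fix n
      show "c0_nth x n \<le> c0_nth y n"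
      proof (cases "\<exists>e\<in>unit_atoms. 0 < c0_nth e n")
        case True
        then obtain k where k: "0 < c0_nth (e k) n" using e_surj by blast
        have "c0_nth x (a k) \<le> c0_nth y (a k)"
          using le by (simp add: less_eq_c0.rep_eq R_nth)
        then show ?thesis
          using nth_eq_peak[OF e(1) peak k] that k by (simp add: mult_right_mono)
      next
        case False
        then show ?thesis using that unit_atom_exists[of x n] unit_atom_exists[of y n] by force
      qed
    qed
  qed (simp add: less_eq_c0.rep_eq R_nth)
  \<comment> \<open>The supports are disjoint, so each coordinate of the sum comes from at most one
    atom.\<close>
  have sum_bound: "norm (sum e F) \<le> 1" if "finite F" for F
  proof (rule norm_c0_le)
    fix n
    have "c0_nth (sum e F) n = (\<Sum>j\<in>F. c0_nth (e j) n)" by (rule c0_nth_sum)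
    also have "\<bar>\<dots>\<bar> \<le> 1"
    proof (cases "\<exists>k. 0 < c0_nth (e k) n")
      case True
      then obtain k where k: "0 < c0_nth (e k) n" by blast
      have "(\<Sum>j\<in>F. c0_nth (e j) n) = (\<Sum>j\<in>F. if j = k then c0_nth (e k) n else 0)"
        using e_eqD[OF _ k] unit_atom_le_one[OF e(1), of _ n] by (intro sum.cong) (auto simp: less_le)
      then show ?thesis using that unit_atom_le_one[OF e(1), of k n] by simp
    next
      case False
      then have "c0_nth (e k) n = 0" for k
        using unit_atom_le_one[OF e(1), of k n] by (force simp: less_le)
      then show ?thesis by simp
    qed
    finally show "\<bar>c0_nth (sum e F) n\<bar> \<le> 1" .
  qed
  have "bij_betw R S UNIV"
    unfolding bij_betw_def
  proof
    show "inj_on R S" by (rule inj_onI) (metis R_le order_antisym order_refl)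
    have "y \<in> R ` S" for y
    proof -
      let ?h = "\<lambda>k. c0_nth y k *\<^sub>R e k"
      have sm: "summable ?h"
        using c0_nth_tendsto[of y] sum_bound e(1)
        by (intro summable_null_scaleR[where C = 1]) (auto simp: unit_atoms_def)
      have "e k \<in> S" for k using e(1)[of k] by (simp add: unit_atoms_def)
      then have "sum ?h {..<n} \<in> S" for n
        by (intro subspace_sum subspace_scale subspace)
      then have "suminf ?h \<in> S"
        using closed_sequentially[OF cl _ summable_LIMSEQ[OF sm]] by simp
      moreover have "R (suminf ?h) = y"
      proof (rule c0_eqI)
        fix j
        have "(\<lambda>k. c0_nth (?h k) (a j)) sums c0_nth (suminf ?h) (a j)"
          using sm by (intro bounded_linear.sums[OF bounded_linear_c0_nth] summable_sums)
        moreover have "c0_nth (?h k) (a j) = (if k = j then c0_nth y j else 0)" for k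
          by (simp add: scaleR_c0.rep_eq e_a)
        ultimately have "(\<lambda>k. if k = j then c0_nth y j else 0) sums c0_nth (suminf ?h) (a j)" by simp
        then show "c0_nth (R (suminf ?h)) j = c0_nth y j"
          using sums_single[of j "\<lambda>_. c0_nth y j"] sums_unique2 unfolding R_nth by blast
      qed
      ultimately show ?thesis by (metis imageI)
    qed
    then show "R ` S = UNIV" by blast
  qed
  then show ?thesis
    unfolding order_isomorphic_def order_isomorphism_def using R_le by blast
qed

end

section \<open>Combining the implications\<close>

lemma order_isomorphic_trans:
  assumes "order_isomorphic A B" "order_isomorphic B C"
  shows "order_isomorphic A C"
proof -
  obtain f g where f: "bij_betw f A B" "\<And>x y. x \<in> A \<Longrightarrow> y \<in> A \<Longrightarrow> x \<ge> y \<longleftrightarrow> f x \<ge> f y"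
    and g: "bij_betw g B C" "\<And>x y. x \<in> B \<Longrightarrow> y \<in> B \<Longrightarrow> x \<ge> y \<longleftrightarrow> g x \<ge> g y"
    using assms unfolding order_isomorphic_def order_isomorphism_def by (elim exE conjE) simp
  have "f x \<in> B" if "x \<in> A" for x using f(1) that by (rule bij_betw_apply)
  then have "order_isomorphism A C (g \<circ> f)"
    unfolding order_isomorphism_def using bij_betw_trans[OF f(1) g(1)] f(2) g(2) by simp
  then show ?thesis unfolding order_isomorphic_def by blast
qed

theorem theorem4:
  shows "((\<exists>T :: 'e::banach_lattice \<Rightarrow> c0. lattice_isomorphism T)
           \<longleftrightarrow> order_isomorphic (UNIV :: 'e set) (UNIV :: c0 set))
       \<and> (order_isomorphic (UNIV :: 'e set) (UNIV :: c0 set)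
           \<longleftrightarrow> (\<exists>S :: c0 set. closed S \<and> sublattice S \<and> infinite_dimensional S
                  \<and> order_isomorphic (UNIV :: 'e set) S))"
proof (intro conjI iffI)
  show "order_isomorphic (UNIV :: 'e set) (UNIV :: c0 set)"
    if "\<exists>T :: 'e \<Rightarrow> c0. lattice_isomorphism T"
    using that lattice_isomorphism_imp_order_isomorphism unfolding order_isomorphic_def by blast
  show "\<exists>T :: 'e \<Rightarrow> c0. lattice_isomorphism T"
    if "order_isomorphic (UNIV :: 'e set) (UNIV :: c0 set)"
    using that by (rule order_isomorphic_c0_imp_lattice_isomorphic)
  show "\<exists>S :: c0 set. closed S \<and> sublattice S \<and> infinite_dimensional S
      \<and> order_isomorphic (UNIV :: 'e set) S"
    if "order_isomorphic (UNIV :: 'e set) (UNIV :: c0 set)"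
    using that infinite_dimensional_c0
    by (intro exI[of _ UNIV]) (simp add: sublattice_def)
  show "order_isomorphic (UNIV :: 'e set) (UNIV :: c0 set)"
    if "\<exists>S :: c0 set. closed S \<and> sublattice S \<and> infinite_dimensional S
      \<and> order_isomorphic (UNIV :: 'e set) S"
    using that closed_sublattice.order_isomorphic_c0 order_isomorphic_trans
    unfolding closed_sublattice_def by blast
qed

end
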